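(* Every simple, totally disconnected, locally compact contraction group $(G,\alpha)$ is pro-discrete, i.e. every identity neighbourhood of $G$ contains an open normal subgroup of $G$.
   Context: Topological groups are Hausdorff; automorphisms of topological groups are bicontinuous. A contraction group is a pair $(G,\alpha)$ of a topological group $G$ and an automorphism $\alpha$ of $G$ with $\alpha^n(x)\to 1$ as $n\to\infty$ for each $x\in G$. A subgroup $H\le G$ is $\alpha$-stable if $\alpha(H)=H$. $(G,\alpha)$ is simple if $G\neq\mathbf{1}$ and $G$ has no $\alpha$-stable closed normal subgroups except $\mathbf{1}$ and $G$. *)

theory Defs
  imports "HOL-Analysis.Analysis" "HOL-Algebra.Coset"
begin

locale topological_group = group G for G (structure) +
  fixes T :: "'a topology"
  assumes topspace_eq: "topspace T = carrier G"
    and continuous_mult: "continuous_map (prod_topology T T) T (\<lambda>(x, y). x \<otimes> y)"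
    and continuous_inv: "continuous_map T T (\<lambda>x. inv x)"
    and Hausdorff: "Hausdorff_space T"

definition totally_disconnected_space :: "'a topology \<Rightarrow> bool"
  where "totally_disconnected_space T \<longleftrightarrow>
    (\<forall>x \<in> topspace T. connected_component_of_set T x = {x})"

locale contraction_group = topological_group G T for G (structure) and T +
  fixes \<alpha> :: "'a \<Rightarrow> 'a"
  assumes alpha_iso: "\<alpha> \<in> iso G G"
    and alpha_homeo: "homeomorphic_map T T \<alpha>"
    and alpha_contracting:
      "\<And>x. x \<in> carrier G \<Longrightarrow> limitin T (\<lambda>n. (\<alpha> ^^ n) x) \<one> sequentially"

definition stable_under :: "('a \<Rightarrow> 'a) \<Rightarrow> 'a set \<Rightarrow> bool"
  where "stable_under \<alpha> H \<longleftrightarrow> \<alpha> ` H = H"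

locale simple_contraction_group = contraction_group G T \<alpha> for G (structure) and T and \<alpha> +
  assumes nontrivial: "carrier G \<noteq> {\<one>}"
    and no_stable_closed_normal:
      "\<And>N. N \<lhd> G \<Longrightarrow> closedin T N \<Longrightarrow> stable_under \<alpha> N \<Longrightarrow> N = {\<one>} \<or> N = carrier G"

definition pro_discrete :: "('a, 'b) monoid_scheme \<Rightarrow> 'a topology \<Rightarrow> bool"
  where "pro_discrete G T \<longleftrightarrow>
    (\<forall>V \<subseteq> topspace T. \<one>\<^bsub>G\<^esub> \<in> T interior_of V \<longrightarrow>
      (\<exists>N. N \<lhd> G \<and> openin T N \<and> N \<subseteq> V))"

end

theory Submission
  imports Defs
begin

text \<open>
  Van Dantzig's theorem gives arbitrarily small compact open subgroups. A Baire category argument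
  (lemma \<open>small_invariant_subgroup\<close>) shrinks such a subgroup to a compact open subgroup \<open>W\<close> with
  \<open>\<alpha>(W) \<subseteq> W\<close>. Then \<open>G\<close> is the increasing union of the subgroups \<open>\<alpha>\<^sup>-\<^sup>n(W)\<close>, and the subgroups
  \<open>\<alpha>\<^sup>n(W)\<close> form a base of identity neighbourhoods.

  The open normal subgroup comes from the normal core \<open>M\<close> of \<open>W\<close>, the intersection of all
  conjugates of \<open>W\<close>. First, \<open>M\<close> is never trivial, and it even fails to lie in \<open>\<alpha>(W)\<close>. Let \<open>C\<^sub>n\<close> be
  the intersection of the conjugates of \<open>W\<close> by elements of \<open>\<alpha>\<^sup>-\<^sup>n(W)\<close>. Compactness of
  \<open>\<alpha>\<^sup>-\<^sup>n(W)\<close> makes \<open>C\<^sub>n\<close> an identity neighbourhood, so \<open>C\<^sub>n \<noteq> 1\<close> and there is a largest \<open>j\<close> with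
  \<open>C\<^sub>n \<subseteq> \<alpha>\<^sup>j(W)\<close>. The group \<open>\<alpha>\<^sup>-\<^sup>j(C\<^sub>n)\<close> lies in \<open>W\<close> and is normalized by the
  group \<open>\<alpha>\<^sup>-\<^sup>n\<^sup>-\<^sup>j(W)\<close>, which contains \<open>\<alpha>\<^sup>-\<^sup>n(W)\<close>. Hence it is contained in \<open>C\<^sub>n\<close>, and by the
  choice of \<open>j\<close> it is not contained in \<open>\<alpha>(W)\<close> (lemma \<open>local_core_not_contracted\<close>). As \<open>M\<close> is the
  intersection of the decreasing compact sets \<open>C\<^sub>n\<close>, the same follows for \<open>M\<close>
  (lemma \<open>normal_core_not_contracted\<close>).

  Now simplicity is used. The union \<open>P\<close> of the groups \<open>\<alpha>\<^sup>-\<^sup>n(M)\<close> is a nontrivial \<open>\<alpha>\<close>-stable normal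
  subgroup, so it is dense. Density and compactness give a single \<open>n\<close> with
  \<open>W = (W \<inter> \<alpha>\<^sup>-\<^sup>n(M)) \<alpha>(W)\<close>. Applying \<open>\<alpha>\<close> repeatedly refines this to
  \<open>W = (W \<inter> \<alpha>\<^sup>-\<^sup>n(M)) \<alpha>\<^sup>k(W)\<close> for all \<open>k\<close>, and as \<open>\<alpha>\<^sup>-\<^sup>n(M)\<close> is closed, \<open>W \<subseteq> \<alpha>\<^sup>-\<^sup>n(M)\<close>
  (lemma \<open>dense_imp_covered\<close>). So \<open>M\<close> contains the open set \<open>\<alpha>\<^sup>n(W)\<close> and is open, and the open
  normal subgroups \<open>\<alpha>\<^sup>k(M) \<subseteq> \<alpha>\<^sup>k(W)\<close> are arbitrarily small.
\<close>

section \<open>Compact open subgroups and cores in topological groups\<close>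

lemma compactin_incseq_cover:
  fixes U :: "nat \<Rightarrow> 'a set"
  assumes S: "compactin X S" and U: "\<And>n. openin X (U n)" "incseq U" and cov: "S \<subseteq> (\<Union>n. U n)"
  obtains n where "S \<subseteq> U n"
proof -
  obtain \<F> where F: "finite \<F>" "\<F> \<subseteq> range U" "S \<subseteq> \<Union>\<F>"
    using compactinD[OF S, of "range U"] U(1) cov by blast
  then obtain K where K: "finite K" "\<F> = U ` K"
    by (meson finite_subset_image)
  obtain n where n: "\<And>k. k \<in> K \<Longrightarrow> k \<le> n"
    using Max.coboundedI K(1) by blast
  have "S \<subseteq> U n" using F(3) K(2) n U(2) unfolding incseq_def by blast
  then show thesis by (rule that)
qed

context topological_group
begin

lemma cancel_left:
  assumes "x \<in> carrier G" "y \<in> carrier G"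
  shows "inv x \<otimes> (x \<otimes> y) = y" "x \<otimes> (inv x \<otimes> y) = y"
  using assms by (simp_all add: m_assoc[symmetric])

lemma continuous_map_mult:
  assumes "continuous_map X T f" "continuous_map X T g"
  shows "continuous_map X T (\<lambda>x. f x \<otimes> g x)"
proof -
  have "continuous_map X (prod_topology T T) (\<lambda>x. (f x, g x))"
    using assms by (simp add: continuous_map_pairedI)
  from continuous_map_compose[OF this continuous_mult] show ?thesis
    by (simp add: o_def)
qed

lemma continuous_map_inverse:
  assumes "continuous_map X T f"
  shows "continuous_map X T (\<lambda>x. inv (f x))"
  using continuous_map_compose[OF assms continuous_inv] by (simp add: o_def)

lemma continuous_map_conj:
  assumes "g \<in> carrier G"
  shows "continuous_map T T (\<lambda>x. g \<otimes> x \<otimes> inv g)"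
  by (intro continuous_map_mult) (use assms topspace_eq in auto)

lemma open_subgroupI:
  assumes H: "subgroup H G" and ne: "T interior_of H \<noteq> {}"
  shows "openin T H"
proof (subst openin_subopen, intro ballI)
  fix x assume x: "x \<in> H"
  obtain u where u: "u \<in> T interior_of H" using ne by blast
  then have uH: "u \<in> H" using interior_of_subset by fast
  have xu: "x \<in> carrier G" "u \<in> carrier G"
    using x uH H by (auto simp: subgroup.mem_carrier)
  let ?f = "\<lambda>y. (u \<otimes> inv x) \<otimes> y"
  let ?V = "{y \<in> topspace T. ?f y \<in> T interior_of H}"
  have "continuous_map T T ?f"
    by (intro continuous_map_mult) (use xu topspace_eq in auto)
  then have "openin T ?V"
    by (rule openin_continuous_map_preimage) simp
  moreover have "x \<in> ?V"
    using xu u topspace_eq by (simp add: m_assoc)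
  moreover have "?V \<subseteq> H"
  proof
    fix y assume y: "y \<in> ?V"
    then have yc: "y \<in> carrier G" and fy: "?f y \<in> H"
      using topspace_eq interior_of_subset by fast+
    \<comment> \<open>The translate of the given interior to \<open>x\<close> stays in \<open>H\<close>, because both \<open>x\<close> and \<open>u\<close> are in \<open>H\<close>.\<close>
    have "y = (x \<otimes> inv u) \<otimes> ?f y"
      using yc xu by (simp add: m_assoc cancel_left)
    also have "\<dots> \<in> H"
      using fy x uH H by (simp add: subgroup.m_closed subgroup.m_inv_closed)
    finally show "y \<in> H" .
  qed
  ultimately show "\<exists>V. openin T V \<and> x \<in> V \<and> V \<subseteq> H" by blast
qed

lemma open_subgroup_if_nbhd:
  assumes "subgroup H G" "openin T V" "\<one> \<in> V" "V \<subseteq> H"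
  shows "openin T H"
  by (rule open_subgroupI) (use assms interior_of_maximal in fast)+

lemma open_subgroup_closed:
  assumes H: "subgroup H G" and op: "openin T H"
  shows "closedin T H"
  unfolding closedin_def
proof
  show "H \<subseteq> topspace T" using op openin_subset by blast
  show "openin T (topspace T - H)"
  proof (subst openin_subopen, intro ballI)
    fix x assume x: "x \<in> topspace T - H"
    then have xc: "x \<in> carrier G" and xH: "x \<notin> H" using topspace_eq by auto
    let ?V = "{y \<in> topspace T. inv x \<otimes> y \<in> H}"
    have "continuous_map T T (\<lambda>y. inv x \<otimes> y)"
      by (intro continuous_map_mult) (use xc topspace_eq in auto)
    then have "openin T ?V"
      by (rule openin_continuous_map_preimage) (rule op)
    moreover have "x \<in> ?V" using xc H topspace_eq by (simp add: subgroup.one_closed)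
    moreover have "y \<notin> H" if y: "y \<in> ?V" for y
    proof
      assume yH: "y \<in> H"
      have "y \<otimes> inv (inv x \<otimes> y) \<in> H"
        using y yH H by (simp add: subgroup.m_closed subgroup.m_inv_closed)
      moreover have "y \<otimes> inv (inv x \<otimes> y) = x"
        using y xc topspace_eq by (simp add: inv_mult_group m_assoc[symmetric])
      ultimately show False using xH by simp
    qed
    ultimately show "\<exists>V. openin T V \<and> x \<in> V \<and> V \<subseteq> topspace T - H" by blast
  qed
qed

text \<open>
  Each group operation, and each conjugation, is continuous and maps the subgroup into itself,
  hence maps its closure into its closure.
\<close>

lemma normal_closure_of:
  assumes N: "N \<lhd> G"
  shows "T closure_of N \<lhd> G"
  unfolding normal_inv_iff
proof (intro conjI ballI subgroupI)
  have sub: "subgroup N G" using N by (rule normal_imp_subgroup)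
  have Nc: "N \<subseteq> topspace T" using sub subgroup.subset topspace_eq by blast
  show "T closure_of N \<subseteq> carrier G" using closure_of_subset_topspace topspace_eq by metis
  show "T closure_of N \<noteq> {}"
    using closure_of_subset[OF Nc] subgroup.one_closed[OF sub] by blast
  show "inv a \<in> T closure_of N" if "a \<in> T closure_of N" for a
  proof -
    have "(\<lambda>x. inv x) ` N \<subseteq> N" using sub by (auto simp: subgroup.m_inv_closed)
    then show ?thesis
      using continuous_map_image_closure_subset[OF continuous_inv, of N]
        closure_of_mono[of "(\<lambda>x. inv x) ` N" N T] that by blast
  qed
  show "a \<otimes> b \<in> T closure_of N" if "a \<in> T closure_of N" "b \<in> T closure_of N" for a b
  proof -
    let ?m = "\<lambda>(x, y). x \<otimes> y"
    have "?m ` (N \<times> N) \<subseteq> N" using sub by (auto simp: subgroup.m_closed)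
    moreover have "(a, b) \<in> prod_topology T T closure_of (N \<times> N)"
      using that by (simp add: closure_of_Times)
    ultimately show ?thesis
      using continuous_map_image_closure_subset[OF continuous_mult, of "N \<times> N"]
        closure_of_mono[of "?m ` (N \<times> N)" N T] by fastforce
  qed
  show "g \<otimes> h \<otimes> inv g \<in> T closure_of N" if "g \<in> carrier G" "h \<in> T closure_of N" for g h
  proof -
    let ?c = "\<lambda>x. g \<otimes> x \<otimes> inv g"
    have "?c ` N \<subseteq> N" using N that by (auto simp: normal.inv_op_closed2)
    then show ?thesis
      using continuous_map_image_closure_subset[OF continuous_map_conj[OF that(1)], of N]
        closure_of_mono[of "?c ` N" N T] that by blast
  qed
qed

text \<open>
  In a locally compact Hausdorff space a compact component can be separated from the complement of
  any of its open neighbourhoods. Total disconnectedness makes the singleton of the identity a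
  component, so it has a compact open neighbourhood \<open>K\<close> inside \<open>V\<close>. The elements \<open>h\<close> whose right
  translation maps \<open>K\<close> onto \<open>K\<close> form a subgroup. It lies in \<open>K\<close> because the identity does, and the
  tube lemma shows that it is a neighbourhood of the identity.
\<close>

lemma van_Dantzig:
  assumes td: "totally_disconnected_space T" and lc: "locally_compact_space T"
    and V: "openin T V" "\<one> \<in> V"
  obtains U where "subgroup U G" "openin T U" "compactin T U" "U \<subseteq> V"
proof -
  have "neighbourhood_base_of (compactin T) T"
    using locally_compact_space_neighbourhood_base Hausdorff lc by blast
  then obtain O' L where O: "openin T O'" "compactin T L" "\<one> \<in> O'" "O' \<subseteq> L" "L \<subseteq> V"
    using V unfolding neighbourhood_base_of by meson
  have one: "\<one> \<in> topspace T" using topspace_eq by simp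
  have comp: "{\<one>} \<in> connected_components_of T"
    using td one unfolding totally_disconnected_space_def connected_components_of_def by blast
  have "compactin T {\<one>}" "{\<one>} \<subseteq> O'" using one O by auto
  from wilder_locally_compact_component_thm[OF lc Hausdorff comp this(1) O(1) this(2)]
  obtain K K' where K: "openin T K" "openin T K'" "disjnt K K'" "K \<union> K' = topspace T"
      "{\<one>} \<subseteq> K" "K \<subseteq> O'" .
  have "K = topspace T - K'" using K openin_subset by (auto simp: disjnt_iff)
  then have "closedin T K" using K(2) by blast
  then have Kcomp: "compactin T K" using O K(6) by (meson closed_compactin order_trans)
  have Kc: "K \<subseteq> carrier G" using K(1) openin_subset topspace_eq by blast
  \<comment> \<open>Asking for \<open>K h \<subseteq> K\<close> and \<open>K h\<^sup>-\<^sup>1 \<subseteq> K\<close> expresses \<open>K h = K\<close>.\<close>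
  define U where "U = {h \<in> carrier G. \<forall>k\<in>K. k \<otimes> h \<in> K \<and> k \<otimes> inv h \<in> K}"
  have sub: "subgroup U G"
  proof (rule subgroupI)
    show "U \<noteq> {}" using Kc by (auto simp: U_def intro!: exI[of _ "\<one>"])
    fix a b assume "a \<in> U" "b \<in> U"
    then have ab: "a \<in> carrier G" "b \<in> carrier G" and
      k: "\<And>k. k \<in> K \<Longrightarrow> (k \<otimes> a) \<otimes> b \<in> K" "\<And>k. k \<in> K \<Longrightarrow> (k \<otimes> inv b) \<otimes> inv a \<in> K"
      by (auto simp: U_def)
    show "a \<otimes> b \<in> U" using ab k Kc by (auto simp: U_def m_assoc inv_mult_group subset_iff)
  qed (auto simp: U_def)
  have UK: "U \<subseteq> K" using K(5) unfolding U_def by force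
  let ?P = "{p \<in> topspace (prod_topology T T). (\<lambda>(x, y). x \<otimes> y) p \<in> K}"
  have "openin (prod_topology T T) ?P"
    by (rule openin_continuous_map_preimage[OF continuous_mult K(1)])
  moreover have "K \<times> {\<one>} \<subseteq> ?P" using Kc topspace_eq by auto
  ultimately obtain S R where SR: "openin T R" "K \<subseteq> S" "\<one> \<in> R" "S \<times> R \<subseteq> ?P"
    using tube_lemma_left[OF _ Kcomp one] by meson
  have Rc: "R \<subseteq> carrier G" using SR(1) openin_subset topspace_eq by blast
  have KR: "k \<otimes> r \<in> K" if "k \<in> K" "r \<in> R" for k r
    using subsetD[OF SR(4), of "(k, r)"] subsetD[OF SR(2) that(1)] that by auto
  let ?R = "R \<inter> {x \<in> topspace T. inv x \<in> R}"
  have "openin T ?R"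
    using SR(1) openin_continuous_map_preimage[OF continuous_inv SR(1)] by blast
  moreover have "\<one> \<in> ?R" using SR(3) one by simp
  moreover have "?R \<subseteq> U" using KR Rc by (auto simp: U_def)
  ultimately have op: "openin T U" using open_subgroup_if_nbhd sub by blast
  have "compactin T U"
    using closed_compactin[OF Kcomp UK] open_subgroup_closed[OF sub op] by blast
  then show thesis using that sub op UK K(6) O by blast
qed

text \<open>
  If \<open>K\<close> is a subgroup, this is the intersection of the conjugates of \<open>W\<close> by elements of \<open>K\<close>.
  The two cases of interest are \<open>K = \<alpha>\<^sup>-\<^sup>n(W)\<close>, where the core is open by compactness,
  and \<open>K = G\<close>, where it is normal.
\<close>

definition conj_core :: "'a set \<Rightarrow> 'a set \<Rightarrow> 'a set"
  where "conj_core K W = {x \<in> carrier G. \<forall>g\<in>K. g \<otimes> x \<otimes> inv g \<in> W}"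

lemma conj_core_subset:
  assumes "\<one> \<in> K"
  shows "conj_core K W \<subseteq> W"
  using assms by (force simp: conj_core_def)

lemma conj_core_closed:
  assumes K: "K \<subseteq> carrier G" "K \<noteq> {}" and W: "closedin T W"
  shows "closedin T (conj_core K W)"
proof -
  have "conj_core K W = (\<Inter>g\<in>K. {x \<in> topspace T. g \<otimes> x \<otimes> inv g \<in> W})"
    using K(2) topspace_eq by (auto simp: conj_core_def)
  also have "closedin T \<dots>"
    by (rule closedin_INT[OF K(2)])
      (rule closedin_continuous_map_preimage[OF continuous_map_conj W], use K in blast)
  finally show ?thesis .
qed

text \<open>
  Conjugation sends \<open>K \<times> {\<one>}\<close> into \<open>W\<close>; by compactness of \<open>K\<close> it still sends \<open>K \<times> V\<close> into \<open>W\<close>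
  for some neighbourhood \<open>V\<close> of the identity.
\<close>

lemma conj_core_nbhd:
  assumes K: "compactin T K" and W: "openin T W" "\<one> \<in> W"
  obtains V where "openin T V" "\<one> \<in> V" "V \<subseteq> conj_core K W"
proof -
  have Kc: "K \<subseteq> carrier G" using K compactin_subset_topspace topspace_eq by blast
  have one: "\<one> \<in> topspace T" using topspace_eq by simp
  let ?f = "\<lambda>p. fst p \<otimes> snd p \<otimes> inv (fst p)"
  let ?P = "{p \<in> topspace (prod_topology T T). ?f p \<in> W}"
  have "continuous_map (prod_topology T T) T ?f"
    by (intro continuous_map_mult continuous_map_inverse continuous_map_fst continuous_map_snd)
  then have "openin (prod_topology T T) ?P"
    by (rule openin_continuous_map_preimage) (rule W)
  moreover have "K \<times> {\<one>} \<subseteq> ?P" using Kc topspace_eq W(2) by auto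
  ultimately obtain S V where SV: "openin T V" "K \<subseteq> S" "\<one> \<in> V" "S \<times> V \<subseteq> ?P"
    using tube_lemma_left[OF _ K one] by meson
  have "V \<subseteq> conj_core K W"
  proof
    fix v assume v: "v \<in> V"
    then have "v \<in> carrier G" using SV(1) openin_subset topspace_eq by blast
    moreover have "g \<otimes> v \<otimes> inv g \<in> W" if "g \<in> K" for g
      using subsetD[OF SV(4), of "(g, v)"] subsetD[OF SV(2) that] v by auto
    ultimately show "v \<in> conj_core K W" by (simp add: conj_core_def)
  qed
  then show thesis using that SV by blast
qed

lemma conj_core_conj:
  assumes K: "subgroup K G" and x: "x \<in> conj_core K W" and h: "h \<in> K"
  shows "h \<otimes> x \<otimes> inv h \<in> conj_core K W"
proof -
  have c: "x \<in> carrier G" "h \<in> carrier G"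
    using x h K by (auto simp: conj_core_def subgroup.mem_carrier)
  have "g \<otimes> (h \<otimes> x \<otimes> inv h) \<otimes> inv g \<in> W" if g: "g \<in> K" for g
  proof -
    have gc: "g \<in> carrier G" using g K by (simp add: subgroup.mem_carrier)
    have "(g \<otimes> h) \<otimes> x \<otimes> inv (g \<otimes> h) \<in> W"
      using x g h K by (simp add: conj_core_def subgroup.m_closed)
    then show ?thesis using c gc by (simp add: inv_mult_group m_assoc)
  qed
  then show ?thesis using c by (simp add: conj_core_def)
qed

lemma conj_core_subgroup:
  assumes K: "K \<subseteq> carrier G" and W: "subgroup W G"
  shows "subgroup (conj_core K W) G"
proof (rule subgroupI)
  have "\<one> \<in> conj_core K W"
    using K W by (auto simp: conj_core_def subgroup.one_closed subset_iff)
  then show "conj_core K W \<noteq> {}" by blast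
  show "conj_core K W \<subseteq> carrier G" by (auto simp: conj_core_def)
  fix a assume a: "a \<in> conj_core K W"
  then have ac: "a \<in> carrier G" by (simp add: conj_core_def)
  have "g \<otimes> inv a \<otimes> inv g \<in> W" if g: "g \<in> K" for g
  proof -
    have gc: "g \<in> carrier G" using g K by blast
    have "inv (g \<otimes> a \<otimes> inv g) \<in> W"
      using a g W by (simp add: conj_core_def subgroup.m_inv_closed)
    then show ?thesis using gc ac by (simp add: inv_mult_group m_assoc)
  qed
  then show "inv a \<in> conj_core K W" using ac by (simp add: conj_core_def)
  fix b assume b: "b \<in> conj_core K W"
  then have bc: "b \<in> carrier G" by (simp add: conj_core_def)
  have "g \<otimes> (a \<otimes> b) \<otimes> inv g \<in> W" if g: "g \<in> K" for g
  proof -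
    have gc: "g \<in> carrier G" using g K by blast
    have "(g \<otimes> a \<otimes> inv g) \<otimes> (g \<otimes> b \<otimes> inv g) \<in> W"
      using a b g W by (simp add: conj_core_def subgroup.m_closed)
    moreover have "(g \<otimes> a \<otimes> inv g) \<otimes> (g \<otimes> b \<otimes> inv g) = g \<otimes> (a \<otimes> b) \<otimes> inv g"
      using gc ac bc by (simp add: m_assoc cancel_left)
    ultimately show ?thesis by simp
  qed
  then show "a \<otimes> b \<in> conj_core K W" using ac bc by (simp add: conj_core_def)
qed

lemma normal_core:
  assumes "subgroup W G"
  shows "conj_core (carrier G) W \<lhd> G"
  unfolding normal_inv_iff
  using conj_core_subgroup[OF subset_refl assms] conj_core_conj[OF subgroup_self] by blast

end

section \<open>Powers of a contractive automorphism\<close>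

context contraction_group
begin

lemma pow_homeo: "homeomorphic_map T T (\<alpha> ^^ n)"
proof (induction n)
  case 0
  show ?case using homeomorphic_map_id[of T T] by (simp only: funpow_0 funpow.simps)
next
  case (Suc n)
  show ?case using homeomorphic_map_compose[OF Suc alpha_homeo] by (simp only: funpow.simps)
qed

lemma pow_iso: "\<alpha> ^^ n \<in> iso G G"
proof (induction n)
  case 0
  show ?case using iso_set_refl by (simp add: id_def)
next
  case (Suc n)
  show ?case using iso_set_trans[OF Suc alpha_iso] by (simp only: funpow.simps)
qed

lemma pow_hom: "group_hom G G (\<alpha> ^^ n)"
  using pow_iso by (auto simp: group_hom_def group_hom_axioms_def iso_def is_group)

lemma pow_closed: "x \<in> carrier G \<Longrightarrow> (\<alpha> ^^ n) x \<in> carrier G"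
  by (rule group_hom.hom_closed[OF pow_hom])

lemma pow_one: "(\<alpha> ^^ n) \<one> = \<one>"
  by (rule group_hom.hom_one[OF pow_hom])

lemma pow_mult:
  "x \<in> carrier G \<Longrightarrow> y \<in> carrier G \<Longrightarrow> (\<alpha> ^^ n) (x \<otimes> y) = (\<alpha> ^^ n) x \<otimes> (\<alpha> ^^ n) y"
  by (rule group_hom.hom_mult[OF pow_hom])

lemma pow_inv: "x \<in> carrier G \<Longrightarrow> (\<alpha> ^^ n) (inv x) = inv ((\<alpha> ^^ n) x)"
  by (rule group_hom.hom_inv[OF pow_hom])

lemma pow_inj: "x \<in> carrier G \<Longrightarrow> y \<in> carrier G \<Longrightarrow> (\<alpha> ^^ n) x = (\<alpha> ^^ n) y \<Longrightarrow> x = y"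
  using pow_iso[of n] by (auto simp: iso_def bij_betw_def inj_on_def)

lemma pow_surj: "(\<alpha> ^^ n) ` carrier G = carrier G"
  using pow_iso[of n] by (auto simp: iso_def bij_betw_def)

lemma pow_commute: "(\<alpha> ^^ m) ((\<alpha> ^^ n) x) = (\<alpha> ^^ n) ((\<alpha> ^^ m) x)"
  by (metis add.commute comp_apply funpow_add)

lemma pow_conj:
  "g \<in> carrier G \<Longrightarrow> x \<in> carrier G \<Longrightarrow>
    (\<alpha> ^^ n) (g \<otimes> x \<otimes> inv g) = (\<alpha> ^^ n) g \<otimes> (\<alpha> ^^ n) x \<otimes> inv ((\<alpha> ^^ n) g)"
  by (simp add: pow_mult pow_inv pow_closed)

lemma pow_invariant:
  assumes "\<alpha> ` X \<subseteq> X" "x \<in> X"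
  shows "(\<alpha> ^^ n) x \<in> X"
  using assms by (induction n) auto

lemma pow_image_normal:
  assumes N: "N \<lhd> G"
  shows "(\<alpha> ^^ n) ` N \<lhd> G"
  unfolding normal_inv_iff
proof (intro conjI ballI)
  show "subgroup ((\<alpha> ^^ n) ` N) G"
    using group_hom.subgroup_img_is_subgroup[OF pow_hom normal_imp_subgroup[OF N]] .
  fix g h assume g: "g \<in> carrier G" and h: "h \<in> (\<alpha> ^^ n) ` N"
  have "g \<in> (\<alpha> ^^ n) ` carrier G" using g pow_surj by simp
  then obtain g' h' where g': "g' \<in> carrier G" "g = (\<alpha> ^^ n) g'" and h': "h' \<in> N" "h = (\<alpha> ^^ n) h'"
    using h by blast
  moreover have "h' \<in> carrier G"
    using h'(1) normal_imp_subgroup[OF N] by (simp add: subgroup.mem_carrier)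
  ultimately have "g \<otimes> h \<otimes> inv g = (\<alpha> ^^ n) (g' \<otimes> h' \<otimes> inv g')"
    by (simp add: pow_conj)
  then show "g \<otimes> h \<otimes> inv g \<in> (\<alpha> ^^ n) ` N"
    using normal.inv_op_closed2[OF N g'(1) h'(1)] by blast
qed

lemma eventually_in_nbhd:
  assumes "x \<in> carrier G" "openin T V" "\<one> \<in> V"
  obtains m where "\<And>n. n \<ge> m \<Longrightarrow> (\<alpha> ^^ n) x \<in> V"
  using alpha_contracting[OF assms(1)] assms(2,3)
  unfolding limitin_def eventually_sequentially by blast

text \<open>
  This is \<open>\<alpha>\<^sup>-\<^sup>n(X)\<close>; writing it as a preimage avoids carrying an inverse of \<open>\<alpha>\<close> around, which as
  a function on the whole type would only be meaningful on the carrier.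
\<close>

definition pullback :: "nat \<Rightarrow> 'a set \<Rightarrow> 'a set"
  where "pullback n X = {x \<in> carrier G. (\<alpha> ^^ n) x \<in> X}"

lemma pullback_subset: "pullback n X \<subseteq> carrier G"
  by (auto simp: pullback_def)

lemma pullback_subgroup:
  assumes "subgroup H G"
  shows "subgroup (pullback n H) G"
proof (rule subgroupI)
  have "\<one> \<in> pullback n H" using assms by (simp add: pullback_def pow_one subgroup.one_closed)
  then show "pullback n H \<noteq> {}" by blast
qed (use assms in \<open>auto simp: pullback_def pow_mult pow_inv subgroup.m_closed subgroup.m_inv_closed\<close>)

lemma pullback_normal:
  assumes "N \<lhd> G"
  shows "pullback n N \<lhd> G"
  unfolding normal_inv_iff
  using pullback_subgroup[OF normal_imp_subgroup[OF assms]] normal.inv_op_closed2[OF assms]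
  by (auto simp: pullback_def pow_conj pow_closed)

lemma pullback_open: "openin T X \<Longrightarrow> openin T (pullback n X)"
  using openin_continuous_map_preimage[OF homeomorphic_imp_continuous_map[OF pow_homeo]]
  by (simp add: pullback_def topspace_eq)

lemma pullback_closed: "closedin T X \<Longrightarrow> closedin T (pullback n X)"
  using closedin_continuous_map_preimage[OF homeomorphic_imp_continuous_map[OF pow_homeo]]
  by (simp add: pullback_def topspace_eq)

lemma image_pullback:
  assumes "X \<subseteq> carrier G"
  shows "(\<alpha> ^^ n) ` pullback n X = X"
proof
  show "(\<alpha> ^^ n) ` pullback n X \<subseteq> X" by (auto simp: pullback_def)
  show "X \<subseteq> (\<alpha> ^^ n) ` pullback n X"
  proof
    fix y assume y: "y \<in> X"
    then have "y \<in> (\<alpha> ^^ n) ` carrier G" using assms pow_surj by blast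
    then show "y \<in> (\<alpha> ^^ n) ` pullback n X" using y by (auto simp: pullback_def)
  qed
qed

lemma pullback_compact:
  assumes X: "compactin T X"
  shows "compactin T (pullback n X)"
proof -
  have "X \<subseteq> carrier G" using compactin_subset_topspace[OF X] topspace_eq by simp
  then show ?thesis
    using homeomorphic_map_compactness[OF pow_homeo, of "pullback n X" n]
      pullback_subset[of n X] X topspace_eq by (simp add: image_pullback)
qed

lemma pow_image_open: "openin T X \<Longrightarrow> openin T ((\<alpha> ^^ n) ` X)"
  using homeomorphic_map_openness[OF pow_homeo] openin_subset by blast

lemma pullback_mono:
  assumes "\<alpha> ` X \<subseteq> X" "m \<le> n"
  shows "pullback m X \<subseteq> pullback n X"
proof -
  obtain k where "n = k + m" using assms(2) le_iff_add add.commute by metis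
  then show ?thesis using pow_invariant[OF assms(1)] by (auto simp: pullback_def funpow_add)
qed

lemma incseq_pullback: "\<alpha> ` X \<subseteq> X \<Longrightarrow> incseq (\<lambda>n. pullback n X)"
  by (simp add: incseq_def pullback_mono)

lemma pullback_exhausts:
  assumes "openin T V" "\<one> \<in> V"
  shows "carrier G \<subseteq> (\<Union>n. pullback n V)"
proof
  fix x assume x: "x \<in> carrier G"
  obtain n where "(\<alpha> ^^ n) x \<in> V"
    using eventually_in_nbhd[OF x assms] by blast
  then show "x \<in> (\<Union>n. pullback n V)" using x by (auto simp: pullback_def)
qed

lemma Union_pullback_stable:
  assumes "\<alpha> ` X \<subseteq> X"
  shows "stable_under \<alpha> (\<Union>n. pullback n X)"
  unfolding stable_under_def
proof (intro equalityI subsetI)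
  fix y assume "y \<in> \<alpha> ` (\<Union>n. pullback n X)"
  then obtain x n where x: "x \<in> carrier G" "(\<alpha> ^^ n) x \<in> X" "y = \<alpha> x"
    by (auto simp: pullback_def)
  then have "(\<alpha> ^^ n) y \<in> X" "y \<in> carrier G"
    using assms pow_commute[of n 1 x] pow_closed[of x 1] by auto
  then show "y \<in> (\<Union>n. pullback n X)" by (auto simp: pullback_def)
next
  fix y assume "y \<in> (\<Union>n. pullback n X)"
  then obtain n where y: "y \<in> carrier G" "(\<alpha> ^^ n) y \<in> X" by (auto simp: pullback_def)
  then obtain x where x: "x \<in> carrier G" "y = \<alpha> x" using pow_surj[of 1] by auto
  have "(\<alpha> ^^ Suc n) x \<in> X" using x y by (simp only: funpow_Suc_right) simp
  then show "y \<in> \<alpha> ` (\<Union>n. pullback n X)" using x by (auto simp: pullback_def simp del: funpow.simps)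
qed

text \<open>
  Invariance of \<open>N\<close> makes the pullbacks an increasing chain, which is what closure under
  multiplication needs.
\<close>

lemma Union_pullback_normal:
  assumes N: "N \<lhd> G" and inv: "\<alpha> ` N \<subseteq> N"
  shows "(\<Union>n. pullback n N) \<lhd> G"
  unfolding normal_inv_iff
proof (intro conjI ballI subgroupI)
  let ?P = "\<Union>n. pullback n N"
  note sub = normal_imp_subgroup[OF pullback_normal[OF N]]
  show "?P \<subseteq> carrier G" using pullback_subset by blast
  show "?P \<noteq> {}" using subgroup.one_closed[OF sub] by blast
  show "inv a \<in> ?P" if "a \<in> ?P" for a
    using that subgroup.m_inv_closed[OF sub] by blast
  show "g \<otimes> a \<otimes> inv g \<in> ?P" if "g \<in> carrier G" "a \<in> ?P" for g a
    using that normal.inv_op_closed2[OF pullback_normal[OF N]] by blast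
  show "a \<otimes> b \<in> ?P" if ab: "a \<in> ?P" "b \<in> ?P" for a b
  proof -
    obtain m n where "a \<in> pullback m N" "b \<in> pullback n N" using ab by blast
    then have "a \<in> pullback (max m n) N" "b \<in> pullback (max m n) N"
      using pullback_mono[OF inv, of m "max m n"] pullback_mono[OF inv, of n "max m n"] by auto
    then show ?thesis using subgroup.m_closed[OF sub] by blast
  qed
qed

lemma stable_closure_of:
  assumes "stable_under \<alpha> X" "X \<subseteq> carrier G"
  shows "stable_under \<alpha> (T closure_of X)"
  using homeomorphic_map_closure_of[OF alpha_homeo, of X] assms topspace_eq
  by (simp add: stable_under_def)

lemma not_discrete:
  assumes "carrier G \<noteq> {\<one>}"
  shows "\<not> openin T {\<one>}"
proof
  assume op: "openin T {\<one>}"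
  have "x = \<one>" if x: "x \<in> carrier G" for x
  proof -
    obtain n where "(\<alpha> ^^ n) x = \<one>"
      using eventually_in_nbhd[OF x op] by blast
    then show ?thesis using pow_inj[OF x one_closed, of n] by (simp add: pow_one)
  qed
  then show False using assms one_closed by blast
qed

end

section \<open>Invariant compact open subgroups\<close>

locale tdlc_contraction_group = contraction_group G T \<alpha> for G (structure) and T and \<alpha> +
  assumes td: "totally_disconnected_space T" and lc: "locally_compact_space T"
begin

text \<open>
  Let \<open>U\<close> be a compact open subgroup and \<open>H n\<close> the closed subgroup of those \<open>x\<close> with
  \<open>\<alpha>\<^sup>k(x) \<in> U\<close> for all \<open>k \<ge> n\<close>. Contraction says that the \<open>H n\<close> exhaust \<open>G\<close>, so by the Baire category
  theorem some \<open>H n\<close> has interior points and is open. As \<open>\<alpha>\<^sup>n(H n) \<subseteq> H 0\<close>, the group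
  \<open>H 0\<close> is open too, and \<open>H 0\<close> is invariant by construction.
\<close>

lemma small_invariant_subgroup:
  assumes V: "openin T V" "\<one> \<in> V"
  obtains W where "subgroup W G" "openin T W" "compactin T W" "\<alpha> ` W \<subseteq> W" "W \<subseteq> V"
proof -
  obtain U where U: "subgroup U G" "openin T U" "compactin T U" "U \<subseteq> V"
    using van_Dantzig[OF td lc V] .
  have clU: "closedin T U" using compactin_imp_closedin[OF Hausdorff U(3)] .
  define H where "H n = (\<Inter>k\<in>{n..}. pullback k U)" for n
  have sub: "subgroup (H n) G" for n
    unfolding H_def by (rule subgroups_Inter) (auto intro: pullback_subgroup U)
  have cl: "closedin T (H n)" for n
    unfolding H_def by (rule closedin_INT) (auto intro: pullback_closed clU)
  have "carrier G \<subseteq> (\<Union>n. H n)"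
  proof
    fix x assume x: "x \<in> carrier G"
    obtain m where "\<And>n. n \<ge> m \<Longrightarrow> (\<alpha> ^^ n) x \<in> U"
      using eventually_in_nbhd[OF x U(2) subgroup.one_closed[OF U(1)]] by blast
    then show "x \<in> (\<Union>n. H n)" using x by (auto simp: H_def pullback_def)
  qed
  then have un: "\<Union>(range H) = topspace T"
    using topspace_eq subgroup.subset[OF sub] by auto
  obtain n where n: "T interior_of (H n) \<noteq> {}"
  proof (rule ccontr)
    assume "\<not> thesis"
    then have "T interior_of H n = {}" for n using that by blast
    then have "T interior_of \<Union>(range H) = {}"
      using locally_compact_Hausdorff_imp_regular_space[OF lc Hausdorff] lc cl
      by (intro Baire_category_alt) auto
    then have "carrier G = {}"
      using un topspace_eq interior_of_topspace[of T] by simp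
    then show False using one_closed by blast
  qed
  then have "openin T ((\<alpha> ^^ n) ` H n)"
    using pow_image_open open_subgroupI[OF sub] by blast
  moreover have "(\<alpha> ^^ n) ` H n \<subseteq> H 0"
  proof clarify
    fix x assume x: "x \<in> H n"
    have "(\<alpha> ^^ (k + n)) x \<in> U" for k using x by (auto simp: H_def pullback_def)
    then show "(\<alpha> ^^ n) x \<in> H 0"
      using x subgroup.mem_carrier[OF sub x] by (auto simp: H_def pullback_def pow_closed funpow_add)
  qed
  moreover have "\<one> \<in> (\<alpha> ^^ n) ` H n"
    using subgroup.one_closed[OF sub] pow_one by (metis image_eqI)
  ultimately have op: "openin T (H 0)" using open_subgroup_if_nbhd[OF sub] by blast
  have H0: "H 0 = {x \<in> carrier G. \<forall>k. (\<alpha> ^^ k) x \<in> U}"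
    by (auto simp: H_def pullback_def)
  have HU: "H 0 \<subseteq> U"
  proof
    fix x assume "x \<in> H 0"
    then have "(\<alpha> ^^ 0) x \<in> U" unfolding H0 by blast
    then show "x \<in> U" by simp
  qed
  have "\<alpha> x \<in> H 0" if x: "x \<in> H 0" for x
  proof -
    have "(\<alpha> ^^ Suc k) x \<in> U" for k using x unfolding H0 by blast
    then have "(\<alpha> ^^ k) (\<alpha> x) \<in> U" for k by (simp add: funpow_swap1)
    moreover have "\<alpha> x \<in> carrier G"
      using pow_closed[of x 1] subgroup.mem_carrier[OF sub x] by simp
    ultimately show ?thesis by (simp add: H0)
  qed
  then show thesis
    using that[of "H 0"] sub op closed_compactin[OF U(3) HU cl] HU U(4) by blast
qed

end

locale invariant_compact_open_subgroup = tdlc_contraction_group G T \<alpha>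
  for G (structure) and T and \<alpha> + fixes W
  assumes sub: "subgroup W G" and op: "openin T W" and comp: "compactin T W"
    and inv: "\<alpha> ` W \<subseteq> W"
begin

lemma one_W: "\<one> \<in> W"
  by (rule subgroup.one_closed[OF sub])

lemma W_subset: "W \<subseteq> carrier G"
  by (rule subgroup.subset[OF sub])

lemma closed: "closedin T W"
  by (rule compactin_imp_closedin[OF Hausdorff comp])

text \<open>
  Pointwise contraction becomes uniform on the compact group \<open>W\<close>: the pullbacks of a small
  invariant open subgroup \<open>U\<close> form an increasing open cover of \<open>W\<close>, so one of them contains \<open>W\<close>.
\<close>

lemma images_shrink:
  assumes V: "openin T V" "\<one> \<in> V"
  obtains n where "(\<alpha> ^^ n) ` W \<subseteq> V"
proof -
  obtain U where U: "subgroup U G" "openin T U" "\<alpha> ` U \<subseteq> U" "U \<subseteq> V"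
    using small_invariant_subgroup[OF V] by metis
  have "W \<subseteq> (\<Union>n. pullback n U)"
    using pullback_exhausts[OF U(2) subgroup.one_closed[OF U(1)]] W_subset by blast
  then obtain n where "W \<subseteq> pullback n U"
    using compactin_incseq_cover[OF comp pullback_open[OF U(2)] incseq_pullback[OF U(3)]] by blast
  then have "(\<alpha> ^^ n) ` W \<subseteq> V" using U(4) by (auto simp: pullback_def)
  then show thesis by (rule that)
qed

text \<open>
  The core \<open>C\<close> of \<open>W\<close> in \<open>\<alpha>\<^sup>-\<^sup>n(W)\<close> is a neighbourhood of the identity in a non-discrete group,
  so \<open>C \<subseteq> \<alpha>\<^sup>j(W)\<close> holds for \<open>j = 0\<close> but not for all \<open>j\<close>. At the last \<open>j\<close> for which it holds, apply
  \<open>\<alpha>\<^sup>-\<^sup>j\<close>: since \<open>\<alpha>\<^sup>-\<^sup>n(W)\<close> is mapped into itself by \<open>\<alpha>\<^sup>j\<close>, the group \<open>\<alpha>\<^sup>-\<^sup>j(C)\<close> is a subgroup of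
  \<open>W\<close> normalized by \<open>\<alpha>\<^sup>-\<^sup>n(W)\<close>, hence is contained in \<open>C\<close>, and it is not contained in \<open>\<alpha>(W)\<close>.
\<close>

lemma local_core_not_contracted:
  assumes nontriv: "carrier G \<noteq> {\<one>}"
  shows "\<not> conj_core (pullback n W) W \<subseteq> \<alpha> ` W"
proof -
  let ?A = "pullback n W" and ?B = "\<lambda>j. (\<alpha> ^^ j) ` W"
  let ?C = "conj_core ?A W"
  have Asub: "subgroup ?A G" by (rule pullback_subgroup[OF sub])
  have CW: "?C \<subseteq> W" by (rule conj_core_subset[OF subgroup.one_closed[OF Asub]])
  obtain V where V: "openin T V" "\<one> \<in> V" "V \<subseteq> ?C"
    using conj_core_nbhd[OF pullback_compact[OF comp] op one_W] .
  have "V \<noteq> {\<one>}" using not_discrete[OF nontriv] V(1) by blast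
  then obtain v where v: "v \<in> V" "v \<noteq> \<one>" using V(2) by blast
  have "openin T (topspace T - {v})"
    using v V(1) openin_subset closedin_Hausdorff_singleton[OF Hausdorff] by blast
  then obtain k where "?B k \<subseteq> topspace T - {v}"
    using images_shrink v(2) topspace_eq one_closed by (metis DiffI singletonD)
  then have k: "\<not> ?C \<subseteq> ?B k" using v V(3) by blast
  \<comment> \<open>The first failing index is positive because \<open>?C \<subseteq> W = ?B 0\<close>; its predecessor is the \<open>j\<close> wanted.\<close>
  define i where "i = (LEAST k. \<not> ?C \<subseteq> ?B k)"
  have i: "\<not> ?C \<subseteq> ?B i" unfolding i_def using k by (rule LeastI)
  then have "i \<noteq> 0" using CW by (cases "i = 0") auto
  then obtain j where j: "i = Suc j" using not0_implies_Suc by blast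
  have Cj: "?C \<subseteq> ?B j" using not_less_Least[of j "\<lambda>k. \<not> ?C \<subseteq> ?B k"] j i_def by simp
  \<comment> \<open>The witness is \<open>x = \<alpha>\<^sup>-\<^sup>j(y)\<close> for some \<open>y\<close> in \<open>?C\<close> outside \<open>\<alpha>\<^sup>j\<^sup>+\<^sup>1(W)\<close>.\<close>
  obtain y where y: "y \<in> ?C" "y \<notin> ?B (Suc j)" using i j by blast
  then obtain x where x: "x \<in> W" "y = (\<alpha> ^^ j) x" using Cj by blast
  have xc: "x \<in> carrier G" using x W_subset by blast
  have "g \<otimes> x \<otimes> inv g \<in> W" if g: "g \<in> ?A" for g
  proof -
    have gc: "g \<in> carrier G" using g pullback_subset by blast
    have "(\<alpha> ^^ j) g \<in> ?A"
      using g pow_invariant[OF inv] pow_commute[of n j g] by (auto simp: pullback_def pow_closed)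
    then have "(\<alpha> ^^ j) (g \<otimes> x \<otimes> inv g) \<in> ?C"
      using conj_core_conj[OF Asub y(1)] x(2) gc xc by (simp add: pow_conj)
    then obtain w where w: "w \<in> W" "(\<alpha> ^^ j) (g \<otimes> x \<otimes> inv g) = (\<alpha> ^^ j) w"
      using Cj by blast
    then have "g \<otimes> x \<otimes> inv g = w" using pow_inj[of _ w j] gc xc W_subset by blast
    then show ?thesis using w by simp
  qed
  then have "x \<in> ?C" using xc by (simp add: conj_core_def)
  moreover have "x \<notin> \<alpha> ` W"
  proof
    assume "x \<in> \<alpha> ` W"
    then obtain w where "w \<in> W" "x = \<alpha> w" by blast
    then have "y = (\<alpha> ^^ Suc j) w" using x(2) by (simp add: funpow_swap1)
    then show False using y(2) \<open>w \<in> W\<close> by blast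
  qed
  ultimately show ?thesis by blast
qed

text \<open>
  As the groups \<open>\<alpha>\<^sup>-\<^sup>n(W)\<close> exhaust \<open>G\<close>, the normal core is the intersection of the local cores.
  Each of these has points outside the open set \<open>\<alpha>(W)\<close>, and by compactness of \<open>W\<close> these remnants have
  a common point.
\<close>

lemma normal_core_not_contracted:
  assumes nontriv: "carrier G \<noteq> {\<one>}"
  shows "\<not> conj_core (carrier G) W \<subseteq> \<alpha> ` W"
proof -
  define D where "D n = conj_core (pullback n W) W - \<alpha> ` W" for n
  have "(\<Inter>n. D n) \<noteq> {}"
  proof (rule compact_space_imp_nest[of "subtopology T W"])
    show "compact_space (subtopology T W)" by (rule compact_space_subtopology[OF comp])
    show "D n \<noteq> {}" for n
      using local_core_not_contracted[OF nontriv, of n] by (auto simp: D_def)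
    show "decseq D"
      unfolding D_def decseq_def conj_core_def using pullback_mono[OF inv] by blast
    fix n
    have one: "\<one> \<in> pullback n W" using one_W by (simp add: pullback_def pow_one)
    then have "closedin T (conj_core (pullback n W) W)"
      using conj_core_closed[OF pullback_subset _ closed] by blast
    then have "closedin T (D n)"
      unfolding D_def using pow_image_open[OF op, of 1] by (intro closedin_diff) auto
    moreover have "D n \<subseteq> W" unfolding D_def using conj_core_subset[OF one] by blast
    ultimately show "closedin (subtopology T W) (D n)" by (rule closedin_subset_topspace)
  qed
  then obtain x where x: "\<And>n. x \<in> D n" by blast
  have "g \<otimes> x \<otimes> inv g \<in> W" if g: "g \<in> carrier G" for g
  proof -
    obtain n where "g \<in> pullback n W" using pullback_exhausts[OF op one_W] g by blast
    then show ?thesis using x[of n] by (simp add: D_def conj_core_def)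
  qed
  then have "x \<in> conj_core (carrier G) W"
    using x[of 0] by (simp add: D_def conj_core_def)
  then show ?thesis using x[of 0] by (auto simp: D_def)
qed

lemma normal_core_invariant: "\<alpha> ` conj_core (carrier G) W \<subseteq> conj_core (carrier G) W"
proof clarify
  fix x assume x: "x \<in> conj_core (carrier G) W"
  then have xc: "x \<in> carrier G" by (simp add: conj_core_def)
  have "g \<otimes> \<alpha> x \<otimes> inv g \<in> W" if g: "g \<in> carrier G" for g
  proof -
    obtain h where h: "h \<in> carrier G" "g = \<alpha> h" using g pow_surj[of 1] by auto
    then have "g \<otimes> \<alpha> x \<otimes> inv g = \<alpha> (h \<otimes> x \<otimes> inv h)"
      using pow_conj[of h x 1] xc by simp
    also have "\<dots> \<in> W" using x h inv by (auto simp: conj_core_def)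
    finally show ?thesis .
  qed
  then show "\<alpha> x \<in> conj_core (carrier G) W"
    using pow_closed[OF xc, of 1] by (simp add: conj_core_def)
qed

text \<open>
  Density gives, for each \<open>w\<close> in \<open>W\<close>, some \<open>p\<close> in \<open>W\<close> and in a pullback of \<open>M\<close> with
  \<open>w \<in> p \<alpha>(W)\<close>; compactness makes the index \<open>n\<close> of the pullback uniform in \<open>w\<close>. The group
  \<open>P n = W \<inter> \<alpha>\<^sup>-\<^sup>n(M)\<close> is mapped into itself by \<open>\<alpha>\<close>, so this approximation can be iterated without
  increasing \<open>n\<close>: if \<open>w = p \<alpha>\<^sup>k(v)\<close> and \<open>v \<in> q \<alpha>(W)\<close>, then \<open>w \<in> p \<alpha>\<^sup>k(q) \<alpha>\<^sup>k\<^sup>+\<^sup>1(W)\<close>.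
  Thus every \<open>w\<close> in \<open>W\<close> is a limit of elements of \<open>\<alpha>\<^sup>-\<^sup>n(M)\<close>, which is closed.
\<close>

lemma dense_imp_covered:
  assumes M: "subgroup M G" "closedin T M" "\<alpha> ` M \<subseteq> M"
    and dense: "T closure_of (\<Union>n. pullback n M) = carrier G"
  obtains n where "W \<subseteq> pullback n M"
proof -
  define P where "P n = W \<inter> pullback n M" for n
  \<comment> \<open>This is \<open>P n \<alpha>(W)\<close>.\<close>
  define Q where "Q n = (\<Union>p\<in>P n. {x \<in> topspace T. inv p \<otimes> x \<in> \<alpha> ` W})" for n
  have opW: "openin T (\<alpha> ` W)" using pow_image_open[OF op, of 1] by simp
  have subW: "subgroup (\<alpha> ` W) G"
    using group_hom.subgroup_img_is_subgroup[OF pow_hom[of 1] sub] by simp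
  have Pc: "P n \<subseteq> carrier G" for n using W_subset by (auto simp: P_def)
  have Psub: "subgroup (P n) G" for n
    unfolding P_def by (rule subgroups_Inter_pair[OF sub pullback_subgroup[OF M(1)]])
  have cm: "continuous_map T T (\<lambda>x. inv p \<otimes> x)" if "p \<in> carrier G" for p
    by (intro continuous_map_mult) (use that topspace_eq in auto)
  have "openin T (Q n)" for n
    unfolding Q_def using Pc[of n]
    by (intro openin_clauses(3) ballI) (auto intro!: openin_continuous_map_preimage[OF cm opW])
  moreover have "incseq Q"
    unfolding incseq_def Q_def P_def using pullback_mono[OF M(3)] by blast
  moreover have "W \<subseteq> (\<Union>n. Q n)"
  proof
    fix w assume w: "w \<in> W"
    then have wc: "w \<in> carrier G" using W_subset by blast
    let ?O = "{p \<in> topspace T. inv p \<otimes> w \<in> \<alpha> ` W} \<inter> W"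
    have "continuous_map T T (\<lambda>p. inv p \<otimes> w)"
      by (intro continuous_map_mult continuous_map_inverse) (use wc topspace_eq in auto)
    then have "openin T ?O"
      using openin_continuous_map_preimage[OF _ opW] op by blast
    moreover have "w \<in> ?O" using w wc topspace_eq subgroup.one_closed[OF subW] by simp
    moreover have "w \<in> T closure_of (\<Union>n. pullback n M)" using dense wc by simp
    ultimately obtain p where p: "p \<in> (\<Union>n. pullback n M)" "p \<in> ?O"
      unfolding in_closure_of by meson
    then obtain n where "p \<in> pullback n M" by blast
    with p(2) have "p \<in> P n" "inv p \<otimes> w \<in> \<alpha> ` W" by (simp_all add: P_def)
    then show "w \<in> (\<Union>n. Q n)" using wc topspace_eq by (auto simp: Q_def)
  qed
  ultimately obtain n where n: "W \<subseteq> Q n"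
    using compactin_incseq_cover[OF comp] by blast
  have Pinv: "\<alpha> ` P n \<subseteq> P n"
  proof clarify
    fix p assume "p \<in> P n"
    then have p: "p \<in> W" "p \<in> carrier G" "(\<alpha> ^^ n) p \<in> M" by (simp_all add: P_def pullback_def)
    have "(\<alpha> ^^ n) (\<alpha> p) \<in> M" using p(3) M(3) by (auto simp flip: funpow_swap1)
    then show "\<alpha> p \<in> P n"
      using p inv pow_closed[of p 1] by (auto simp: P_def pullback_def)
  qed
  have approx: "\<exists>p\<in>P n. inv p \<otimes> w \<in> (\<alpha> ^^ k) ` W" if w: "w \<in> W" for k w
  proof (induction k)
    case 0
    show ?case
      using w W_subset by (auto intro!: bexI[OF _ subgroup.one_closed[OF Psub]])
  next
    case (Suc k)
    then obtain p v where p: "p \<in> P n" and v: "v \<in> W" "inv p \<otimes> w = (\<alpha> ^^ k) v" by blast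
    obtain q u where q: "q \<in> P n" and u: "u \<in> W" "inv q \<otimes> v = \<alpha> u"
      using n v by (auto simp: Q_def)
    let ?q = "(\<alpha> ^^ k) q"
    have q': "?q \<in> P n" using pow_invariant[OF Pinv q] .
    have c: "p \<in> carrier G" "q \<in> carrier G" "v \<in> carrier G" "w \<in> carrier G" "?q \<in> carrier G"
      using p q q' v w Pc W_subset by blast+
    have "inv (p \<otimes> ?q) \<otimes> w = inv ?q \<otimes> (inv p \<otimes> w)"
      using c by (simp add: inv_mult_group m_assoc)
    also have "\<dots> = (\<alpha> ^^ k) (inv q \<otimes> v)" using c v by (simp add: pow_mult pow_inv)
    also have "\<dots> = (\<alpha> ^^ Suc k) u" using u by (simp add: funpow_swap1)
    finally show ?case using subgroup.m_closed[OF Psub p q'] u(1) by blast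
  qed
  have "W \<subseteq> pullback n M"
  proof (rule ccontr)
    assume "\<not> W \<subseteq> pullback n M"
    then obtain w where w: "w \<in> W" "w \<notin> pullback n M" by blast
    have wc: "w \<in> carrier G" using w W_subset by blast
    let ?V = "{v \<in> topspace T. w \<otimes> inv v \<in> topspace T - pullback n M}"
    have "continuous_map T T (\<lambda>v. w \<otimes> inv v)"
      by (intro continuous_map_mult continuous_map_inverse) (use wc topspace_eq in auto)
    then have "openin T ?V"
      using openin_continuous_map_preimage pullback_closed[OF M(2)] by blast
    moreover have "\<one> \<in> ?V" using wc w topspace_eq by simp
    ultimately obtain k where k: "(\<alpha> ^^ k) ` W \<subseteq> ?V" by (rule images_shrink)
    obtain p where p: "p \<in> P n" "inv p \<otimes> w \<in> ?V" using approx[OF w(1), of k] k by blast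
    have "w \<otimes> inv (inv p \<otimes> w) = p"
      using p(1) Pc wc by (auto simp: inv_mult_group cancel_left subset_iff)
    then show False using p by (auto simp: P_def)
  qed
  then show thesis by (rule that)
qed

end

section \<open>Simple contraction groups\<close>

theorem corollary4p7:
  fixes G :: "('a, 'b) monoid_scheme" and T :: "'a topology" and \<alpha> :: "'a \<Rightarrow> 'a"
  assumes "simple_contraction_group G T \<alpha>"
    and "totally_disconnected_space T"
    and "locally_compact_space T"
  shows "pro_discrete G T"
proof -
  interpret simple_contraction_group G T \<alpha> by fact
  interpret tdlc_contraction_group G T \<alpha> by unfold_locales fact+
  have "\<one>\<^bsub>G\<^esub> \<in> topspace T" using topspace_eq by simp
  then obtain W where "subgroup W G" "openin T W" "compactin T W" "\<alpha> ` W \<subseteq> W"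
    by (rule small_invariant_subgroup[OF openin_topspace])
  then interpret invariant_compact_open_subgroup G T \<alpha> W
    by (intro invariant_compact_open_subgroup.intro invariant_compact_open_subgroup_axioms.intro
        tdlc_contraction_group_axioms)
  define M where "M = conj_core (carrier G) W"
  have M: "M \<lhd> G" "\<alpha> ` M \<subseteq> M" "\<not> M \<subseteq> \<alpha> ` W" "M \<subseteq> W"
    unfolding M_def
    using normal_core[OF sub] normal_core_invariant normal_core_not_contracted[OF nontrivial]
      conj_core_subset[OF one_closed] by auto
  have subM: "subgroup M G" by (rule normal_imp_subgroup[OF M(1)])
  have clM: "closedin T M"
    unfolding M_def by (rule conj_core_closed[OF subset_refl _ closed]) (use one_closed in blast)
  define P where "P = (\<Union>n. pullback n M)"
  have P: "P \<lhd> G" "stable_under \<alpha> P"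
    unfolding P_def by (rule Union_pullback_normal[OF M(1,2)] Union_pullback_stable[OF M(2)])+
  have Pc: "P \<subseteq> carrier G" unfolding P_def using pullback_subset by blast
  \<comment> \<open>The closure of \<open>P\<close> contains \<open>M\<close>, which has elements outside \<open>\<alpha>(W)\<close>; so it is not trivial.\<close>
  have "M = pullback 0 M" using subgroup.subset[OF subM] by (auto simp: pullback_def)
  then have MP: "M \<subseteq> T closure_of P"
    using closure_of_subset[of P T] Pc topspace_eq unfolding P_def by blast
  have "\<one>\<^bsub>G\<^esub> \<in> \<alpha> ` W" using one_W pow_one[of 1] by force
  then have "T closure_of P \<noteq> {\<one>\<^bsub>G\<^esub>}" using M(3) MP by auto
  then have "T closure_of P = carrier G"
    using no_stable_closed_normal[OF normal_closure_of[OF P(1)] closedin_closure_of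
        stable_closure_of[OF P(2) Pc]] by blast
  then obtain n where "W \<subseteq> pullback n M"
    using dense_imp_covered[OF subM clM M(2)] unfolding P_def by blast
  then have "(\<alpha> ^^ n) ` W \<subseteq> M" by (auto simp: pullback_def)
  moreover have "\<one>\<^bsub>G\<^esub> \<in> (\<alpha> ^^ n) ` W" using one_W pow_one[of n] by (metis image_eqI)
  ultimately have opM: "openin T M"
    using open_subgroup_if_nbhd[OF subM pow_image_open[OF op]] by blast
  show ?thesis
    unfolding pro_discrete_def
  proof (intro allI impI)
    fix V assume V: "V \<subseteq> topspace T" "\<one>\<^bsub>G\<^esub> \<in> T interior_of V"
    obtain k where "(\<alpha> ^^ k) ` W \<subseteq> T interior_of V"
      using images_shrink[OF openin_interior_of V(2)] .
    then have "(\<alpha> ^^ k) ` M \<subseteq> V" using M(4) interior_of_subset by fast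
    then show "\<exists>N. N \<lhd> G \<and> openin T N \<and> N \<subseteq> V"
      using pow_image_normal[OF M(1)] pow_image_open[OF opM] by blast
  qed
qed

end
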